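(* If the Model Hypothesis $\mathsf{MH}$ holds, then there exists a pathway.
   Context: For $f,g\in\omega^\omega$, $f\leq^* g$ means $f(n)\leq g(n)$ for all but finitely many $n$. $H(\omega_1)$ is the set of hereditarily countable sets, viewed as a structure with the relation $\in$. "Increasing" for sequences of sets means $\subseteq$-increasing. $\mathsf{MH}$ (Roitman's Model Hypothesis) is the statement: for some infinite cardinal $\kappa$, there is an increasing sequence $\langle M_\alpha:\alpha<\kappa\rangle$ of elementary submodels of $H(\omega_1)$, with $H(\omega_1)=\bigcup_{\alpha<\kappa}M_\alpha$, such that for every $\alpha<\kappa$ there is some $f\in M_{\alpha+1}\cap\omega^\omega$ such that $f\not\leq^* g$ for all $g\in M_\alpha\cap\omega^\omega$. For $f,g\in\omega^\omega$, the join $f\vee g\in\omega^\omega$ is defined by $(f\vee g)(n)=f(\frac n2)$ if $n$ is even and $(f\vee g)(n)=g(\frac{n+1}{2})$ if $n$ is odd. A pathway is an increasing sequence $\langle A_\alpha:\alpha<\kappa\rangle$ of subsets of $\omega^\omega$, for some infinite cardinal $\kappa$, such that $\bigcup_{\alpha<\kappa}A_\alpha=\omega^\omega$ and, for all $\alpha<\kappa$: (i) $A_\alpha$ does not dominate $A_{\alpha+1}$, i.e., there is $f\in A_{\alpha+1}$ with $f\not\leq^* g$ for all $g\in A_\alpha$; (ii) if $f,g\in A_\alpha$ then $f\vee g\in A_\alpha$; (iii) $A_\alpha$ is closed under Turing reducibility, i.e., if $f\in A_\alpha$ and $g\in\omega^\omega$ is Turing reducible to $f$, then $g\in A_\alpha$.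 *)

theory Defs
  imports Main "HOL-Library.Countable_Set_Type"
begin

section \<open>Hereditarily countable sets\<close>

text \<open>
  The type \<open>hc\<close> is the initial algebra of the countable powerset functor: its elements are exactly
  the sets that can be built up well-foundedly from countable (possibly finite) collections of sets
  built earlier. Injectivity of the constructor is extensionality, and datatype induction is
  \<open>\<in>\<close>-induction, so \<open>(hc, \<in>\<^sub>h)\<close> is the structure \<open>(H(\<omega>\<^sub>1), \<in>)\<close>.
\<close>

datatype hc = HC (elts: "hc cset")

definition hmem :: "hc \<Rightarrow> hc \<Rightarrow> bool" (infix \<open>\<in>\<^sub>h\<close> 50)
  where "x \<in>\<^sub>h y \<longleftrightarrow> cin x (elts y)"

text \<open>Von Neumann numerals, Kuratowski pairs, and functions as their graphs.\<close>

primrec hnat :: "nat \<Rightarrow> hc"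
  where
    "hnat 0 = HC cempty"
  | "hnat (Suc n) = HC (cinsert (hnat n) (elts (hnat n)))"

definition hupair :: "hc \<Rightarrow> hc \<Rightarrow> hc"
  where "hupair x y = HC (cinsert x (cinsert y cempty))"

definition hpair :: "hc \<Rightarrow> hc \<Rightarrow> hc"
  where "hpair x y = hupair (hupair x x) (hupair x y)"

definition hfun :: "(nat \<Rightarrow> nat) \<Rightarrow> hc"
  where "hfun f = HC (acset (range (\<lambda>n. hpair (hnat n) (hnat (f n)))))"

text \<open>\<open>reals M\<close> is the set \<open>M \<inter> \<omega>\<^sup>\<omega>\<close>.\<close>

definition reals :: "hc set \<Rightarrow> (nat \<Rightarrow> nat) set"
  where "reals M = {f. hfun f \<in> M}"


section \<open>Elementary submodels\<close>

text \<open>First-order formulas in the language \<open>{\<in>, =}\<close>, with variables named by natural numbers.\<close>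

datatype fm =
    Mem nat nat
  | Eq nat nat
  | Neg fm
  | Conj fm fm
  | Ex nat fm

primrec sat :: "hc set \<Rightarrow> fm \<Rightarrow> (nat \<Rightarrow> hc) \<Rightarrow> bool"
  where
    "sat M (Mem i j) e \<longleftrightarrow> e i \<in>\<^sub>h e j"
  | "sat M (Eq i j) e \<longleftrightarrow> e i = e j"
  | "sat M (Neg \<phi>) e \<longleftrightarrow> \<not> sat M \<phi> e"
  | "sat M (Conj \<phi> \<psi>) e \<longleftrightarrow> sat M \<phi> e \<and> sat M \<psi> e"
  | "sat M (Ex i \<phi>) e \<longleftrightarrow> (\<exists>x\<in>M. sat M \<phi> (e(i := x)))"

definition elementary_submodel :: "hc set \<Rightarrow> bool"
  where "elementary_submodel M \<longleftrightarrow>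
    M \<noteq> {} \<and> (\<forall>\<phi> e. range e \<subseteq> M \<longrightarrow> (sat M \<phi> e \<longleftrightarrow> sat UNIV \<phi> e))"


section \<open>Turing reducibility\<close>

text \<open>
  Turing reducibility is recursiveness relative to an oracle: the partial functions on \<open>\<nat>\<close> computable
  from \<open>h\<close> are those obtained from zero, successor, projections and \<open>h\<close> itself by composition,
  primitive recursion and unbounded minimisation. \<open>orec\<close> is the type of programs and
  \<open>computes h c xs y\<close> says that \<open>c\<close> with oracle \<open>h\<close> halts on input \<open>xs\<close> with output \<open>y\<close>. Programs carry
  no arity; one applied to an unsuitable number of arguments diverges.
\<close>

datatype orec =
    Zero
  | Succ
  | Proj nat
  | Oracle
  | Comp orec "orec list"
  | PrimRec orec orec
  | Mu orec

inductive computes :: "(nat \<Rightarrow> nat) \<Rightarrow> orec \<Rightarrow> nat list \<Rightarrow> nat \<Rightarrow> bool" for h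
  where
    "computes h Zero xs 0"
  | "computes h Succ [x] (Suc x)"
  | "i < length xs \<Longrightarrow> computes h (Proj i) xs (xs ! i)"
  | "computes h Oracle [x] (h x)"
  | "list_all2 (\<lambda>d y. computes h d xs y) ds ys \<Longrightarrow> computes h c ys z \<Longrightarrow>
      computes h (Comp c ds) xs z"
  | "computes h c xs y \<Longrightarrow> computes h (PrimRec c d) (0 # xs) y"
  | "computes h (PrimRec c d) (n # xs) r \<Longrightarrow> computes h d (n # r # xs) y \<Longrightarrow>
      computes h (PrimRec c d) (Suc n # xs) y"
  | "computes h c (n # xs) 0 \<Longrightarrow> (\<forall>m<n. \<exists>r. r \<noteq> 0 \<and> computes h c (m # xs) r) \<Longrightarrow>
      computes h (Mu c) xs n"

definition turing_reducible :: "(nat \<Rightarrow> nat) \<Rightarrow> (nat \<Rightarrow> nat) \<Rightarrow> bool" (infix \<open>\<le>\<^sub>T\<close> 50)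
  where "g \<le>\<^sub>T f \<longleftrightarrow> (\<exists>c. \<forall>n y. computes f c [n] y \<longleftrightarrow> y = g n)"


section \<open>The Model Hypothesis and pathways\<close>

definition le_star :: "(nat \<Rightarrow> nat) \<Rightarrow> (nat \<Rightarrow> nat) \<Rightarrow> bool" (infix \<open>\<le>\<^sup>*\<close> 50)
  where "f \<le>\<^sup>* g \<longleftrightarrow> finite {n. \<not> f n \<le> g n}"

text \<open>For odd \<open>n\<close> the second argument is read at \<open>(n + 1) / 2 \<ge> 1\<close>, so \<open>g 0\<close> is not encoded.\<close>

definition join :: "(nat \<Rightarrow> nat) \<Rightarrow> (nat \<Rightarrow> nat) \<Rightarrow> nat \<Rightarrow> nat"
  where "join f g n = (if even n then f (n div 2) else g ((n + 1) div 2))"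

text \<open>
  An infinite cardinal \<open>\<kappa>\<close> is a relation with \<open>Cinfinite \<kappa>\<close>; its field plays the role of the set of
  ordinals below \<open>\<kappa>\<close>, and sequences of length \<open>\<kappa>\<close> are functions of which only the values on
  \<open>Field \<kappa>\<close> matter. The field has no last element, so the successor below exists.
\<close>

definition ord_suc :: "'k rel \<Rightarrow> 'k \<Rightarrow> 'k"
  where "ord_suc \<kappa> \<alpha> = wo_rel.suc \<kappa> {\<alpha>}"

definition MH_sequence :: "'k rel \<Rightarrow> ('k \<Rightarrow> hc set) \<Rightarrow> bool"
  where "MH_sequence \<kappa> M \<longleftrightarrow>
    Cinfinite \<kappa> \<and>
    relChain \<kappa> M \<and>
    (\<forall>\<alpha>\<in>Field \<kappa>. elementary_submodel (M \<alpha>)) \<and>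
    (\<Union>\<alpha>\<in>Field \<kappa>. M \<alpha>) = UNIV \<and>
    (\<forall>\<alpha>\<in>Field \<kappa>. \<exists>f\<in>reals (M (ord_suc \<kappa> \<alpha>)). \<forall>g\<in>reals (M \<alpha>). \<not> f \<le>\<^sup>* g)"

definition pathway :: "'k rel \<Rightarrow> ('k \<Rightarrow> (nat \<Rightarrow> nat) set) \<Rightarrow> bool"
  where "pathway \<kappa> A \<longleftrightarrow>
    Cinfinite \<kappa> \<and>
    relChain \<kappa> A \<and>
    (\<Union>\<alpha>\<in>Field \<kappa>. A \<alpha>) = UNIV \<and>
    (\<forall>\<alpha>\<in>Field \<kappa>.
      (\<exists>f\<in>A (ord_suc \<kappa> \<alpha>). \<forall>g\<in>A \<alpha>. \<not> f \<le>\<^sup>* g) \<and>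
      (\<forall>f\<in>A \<alpha>. \<forall>g\<in>A \<alpha>. join f g \<in> A \<alpha>) \<and>
      (\<forall>f\<in>A \<alpha>. \<forall>g. g \<le>\<^sub>T f \<longrightarrow> g \<in> A \<alpha>))"

text \<open>
  HOL cannot quantify over types inside a formula, so the cardinals in \<open>MH\<close> range over those
  represented on a type \<open>'k\<close>; a theorem assuming \<open>MH\<close> for a type variable \<open>'k\<close> covers cardinals of
  every size. Conversely, the condition on \<open>f\<close> makes the sequences strictly increase at successors,
  in \<open>MH_sequence\<close> and in \<open>pathway\<close> alike, so \<open>\<kappa>\<close> is at most the continuum and already represented on
  the type \<open>nat \<Rightarrow> nat\<close>.
\<close>

definition MH :: "'k itself \<Rightarrow> bool"
  where "MH _ \<longleftrightarrow> (\<exists>(\<kappa> :: 'k rel) M. MH_sequence \<kappa> M)"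

end

theory Submission
  imports Defs
begin

text \<open>
  Take \<open>A\<^sub>\<alpha> = M\<^sub>\<alpha> \<inter> \<omega>\<^sup>\<omega>\<close>. If a real \<open>g\<close> is the unique real satisfying a first-order formula in
  \<open>H(\<omega>\<^sub>1)\<close> whose parameters are reals in \<open>M\<close>, then \<open>g\<close> belongs to every elementary submodel \<open>M\<close>. Every
  function from \<open>\<omega>\<close> to \<open>\<omega>\<close> is an element of \<open>H(\<omega>\<^sub>1)\<close>, so everything expressible in second-order
  arithmetic is first-order over \<open>H(\<omega>\<^sub>1)\<close>; in particular joins and the results of oracle computations
  are, primitive recursion being expressed by quantifying over the sequence of its values.
  The unbounded reals added at successor steps are pairwise distinct, so \<open>\<kappa>\<close> embeds in \<open>\<omega>\<^sup>\<omega>\<close>.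
\<close>

section \<open>Definability over the hereditarily countable sets\<close>

text \<open>Parameters enter as values of the environment, so formulas need no names for elements of
  \<open>hc\<close>.\<close>

definition definable :: "((nat \<Rightarrow> hc) \<Rightarrow> bool) \<Rightarrow> bool"
  where "definable P \<longleftrightarrow> (\<exists>\<phi>. \<forall>e. sat UNIV \<phi> e \<longleftrightarrow> P e)"

text \<open>Environments assign values to infinitely many variables; the bound \<open>N\<close>
  supplies fresh ones for the changes of bound variable below.\<close>

lemma sat_finitely_many_variables:
  "\<exists>N. \<forall>e e'. (\<forall>i<N. e i = e' i) \<longrightarrow> sat M \<phi> e = sat M \<phi> e'"
proof (induction \<phi>)
  case (Mem i j)
  show ?case by (rule exI[of _ "Suc (i + j)"]) simp
next
  case (Eq i j)
  show ?case by (rule exI[of _ "Suc (i + j)"]) simp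
next
  case (Conj \<phi> \<psi>)
  then obtain N N' where
    "\<forall>e e'. (\<forall>i<N. e i = e' i) \<longrightarrow> sat M \<phi> e = sat M \<phi> e'"
    "\<forall>e e'. (\<forall>i<N'. e i = e' i) \<longrightarrow> sat M \<psi> e = sat M \<psi> e'" by blast
  then show ?case
    by (intro exI[of _ "N + N'"]) (metis sat.simps(4) trans_less_add1 trans_less_add2)
next
  case (Ex i \<phi>)
  then obtain N where N: "\<And>e e'. \<forall>i<N. e i = e' i \<Longrightarrow> sat M \<phi> e = sat M \<phi> e'" by blast
  have "sat M \<phi> (e(i := x)) = sat M \<phi> (e'(i := x))" if "\<forall>i<N. e i = e' i" for e e' x
    by (rule N) (use that in auto)
  then show ?case by (intro exI[of _ N]) auto
qed auto

text \<open>The map \<open>\<sigma>\<close> may identify variables. To avoid capture, each bound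
  variable is replaced by one outside the image of the variables that matter to its body.\<close>

lemma definable_rename:
  assumes "definable P"
  shows "definable (\<lambda>e. P (\<lambda>i. e (\<sigma> i)))"
proof -
  have "\<exists>\<psi>. \<forall>e. sat UNIV \<psi> e \<longleftrightarrow> sat UNIV \<phi> (\<lambda>i. e (\<sigma> i))" for \<phi>
  proof (induction \<phi> arbitrary: \<sigma>)
    case (Mem i j)
    show ?case by (rule exI[of _ "Mem (\<sigma> i) (\<sigma> j)"]) simp
  next
    case (Eq i j)
    show ?case by (rule exI[of _ "Eq (\<sigma> i) (\<sigma> j)"]) simp
  next
    case (Neg \<phi>)
    then show ?case by (metis sat.simps(3))
  next
    case (Conj \<phi> \<psi>)
    then show ?case by (metis sat.simps(4))
  next
    case (Ex i \<phi>)
    obtain N where N: "\<And>e e'. \<forall>i<N. e i = e' i \<Longrightarrow> sat UNIV \<phi> e = sat UNIV \<phi> e'"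
      using sat_finitely_many_variables[of UNIV \<phi>] by blast
    obtain k where k: "k \<notin> \<sigma> ` {..<N}"
      using ex_new_if_finite[of "\<sigma> ` {..<N}"] by auto
    obtain \<psi> where \<psi>: "\<And>e. sat UNIV \<psi> e \<longleftrightarrow> sat UNIV \<phi> (\<lambda>m. e ((\<sigma>(i := k)) m))"
      using Ex by blast
    \<comment> \<open>The two environments agree below \<open>N\<close>: variable \<open>i\<close>
      reads \<open>x\<close> in both, and no other variable below \<open>N\<close> is sent to
      \<open>k\<close>.\<close>
    have "sat UNIV \<phi> (\<lambda>m. (e(k := x)) ((\<sigma>(i := k)) m)) = sat UNIV \<phi> ((\<lambda>m. e (\<sigma> m))(i := x))" for e x
      by (rule N) (use k in auto)
    then show ?case by (intro exI[of _ "Ex k \<psi>"]) (simp add: \<psi>)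
  qed
  moreover obtain \<phi> where "P = sat UNIV \<phi>"
    using assms unfolding definable_def fun_eq_iff by metis
  ultimately show ?thesis unfolding definable_def by simp
qed

lemma definable_mem: "definable (\<lambda>e. e i \<in>\<^sub>h e j)"
  unfolding definable_def by (rule exI[of _ "Mem i j"]) simp

lemma definable_eq: "definable (\<lambda>e. e i = e j)"
  unfolding definable_def by (rule exI[of _ "Eq i j"]) simp

lemma definable_not: "definable P \<Longrightarrow> definable (\<lambda>e. \<not> P e)"
  unfolding definable_def by (metis sat.simps(3))

lemma definable_conj: "definable P \<Longrightarrow> definable Q \<Longrightarrow> definable (\<lambda>e. P e \<and> Q e)"
  unfolding definable_def by (metis sat.simps(4))

lemma definable_disj:
  assumes "definable P" "definable Q"
  shows "definable (\<lambda>e. P e \<or> Q e)"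
  using definable_not[OF definable_conj[OF assms[THEN definable_not]]] by simp

lemma definable_imp:
  assumes "definable P" "definable Q"
  shows "definable (\<lambda>e. P e \<longrightarrow> Q e)"
  using definable_disj[OF definable_not[OF assms(1)] assms(2)] unfolding imp_conv_disj .

lemma definable_iff:
  assumes "definable P" "definable Q"
  shows "definable (\<lambda>e. P e \<longleftrightarrow> Q e)"
  using definable_conj[OF definable_imp[OF assms] definable_imp[OF assms(2,1)]]
  unfolding iff_conv_conj_imp .

text \<open>
  The bound variable is taken to be number 0 and the others are shifted, so that applying this rule
  to a goal by higher-order unification leaves a premise to which the rules apply again.
\<close>

lemma definable_ex:
  assumes "definable (\<lambda>e. P (\<lambda>i. e (Suc i)) (e 0))"
  shows "definable (\<lambda>e. \<exists>x. P e x)"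
proof -
  obtain \<phi> where \<phi>: "\<And>e. sat UNIV \<phi> e \<longleftrightarrow> P (\<lambda>i. e (Suc i)) (e 0)"
    using assms unfolding definable_def by blast
  obtain N where N: "\<And>e e'. \<forall>i<N. e i = e' i \<Longrightarrow> sat UNIV \<phi> e = sat UNIV \<phi> e'"
    using sat_finitely_many_variables[of UNIV \<phi>] by blast
  have "definable (sat UNIV \<phi>)" unfolding definable_def by blast
  \<comment> \<open>Variable 0 becomes \<open>N\<close> and \<open>Suc i\<close> becomes
    \<open>i\<close>. Overwriting \<open>N\<close> disturbs only the old variable
    \<open>Suc N\<close>, which \<open>\<phi>\<close> ignores.\<close>
  from definable_rename[OF this, of "case_nat N (\<lambda>i. i)"]
  obtain \<psi> where \<psi>: "\<And>e. sat UNIV \<psi> e \<longleftrightarrow> sat UNIV \<phi> (\<lambda>i. e (case_nat N (\<lambda>i. i) i))"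
    unfolding definable_def by blast
  have "sat UNIV \<phi> (\<lambda>i. (e(N := x)) (case_nat N (\<lambda>i. i) i)) = sat UNIV \<phi> (case_nat x e)" for e x
    by (rule N) (auto split: nat.split)
  then have "sat UNIV (Ex N \<psi>) e \<longleftrightarrow> (\<exists>x. P e x)" for e
    by (simp add: \<psi> \<phi>)
  then show ?thesis unfolding definable_def by blast
qed

lemma definable_all:
  assumes "definable (\<lambda>e. P (\<lambda>i. e (Suc i)) (e 0))"
  shows "definable (\<lambda>e. \<forall>x. P e x)"
  using definable_not[OF definable_ex[where P = "\<lambda>e x. \<not> P e x", OF definable_not[OF assms]]] by simp

lemmas definable_intros =
  definable_mem definable_eq definable_not definable_conj definable_disj definable_imp definable_iff
  definable_ex definable_all


section \<open>Natural numbers and functions in the hereditarily countable sets\<close>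

text \<open>Extensionality, from injectivity of the constructor. It turns equations with set terms
  into membership conditions that formulas can express.\<close>

lemma hc_eq_iff: "x = y \<longleftrightarrow> (\<forall>u. u \<in>\<^sub>h x \<longleftrightarrow> u \<in>\<^sub>h y)"
proof -
  have "elts x = elts y" if "\<forall>u. cin u (elts x) \<longleftrightarrow> cin u (elts y)"
    using that by transfer auto
  then show ?thesis unfolding hmem_def using hc.expand by blast
qed

lemma hmem_hnat_0: "\<not> x \<in>\<^sub>h hnat 0"
  unfolding hmem_def by simp

lemma hmem_hnat_Suc: "x \<in>\<^sub>h hnat (Suc n) \<longleftrightarrow> x \<in>\<^sub>h hnat n \<or> x = hnat n"
  unfolding hmem_def by auto

declare hnat.simps [simp del]

lemma hmem_hnat: "x \<in>\<^sub>h hnat n \<longleftrightarrow> (\<exists>m<n. x = hnat m)"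
  by (induction n) (auto simp: hmem_hnat_0 hmem_hnat_Suc less_Suc_eq)

text \<open>By induction on membership: a set belonging to itself would be one of its own elements,
  none of which belongs to itself.\<close>

lemma hmem_irrefl: "\<not> x \<in>\<^sub>h x"
proof (induction x)
  case (HC X)
  then show ?case unfolding hmem_def
    by (metis cin.rep_eq hc.sel)
qed

lemma hnat_inj: "hnat m = hnat n \<longleftrightarrow> m = n"
  by (metis hmem_hnat hmem_irrefl nat_neq_iff)

lemma hmem_hnat_iff: "hnat m \<in>\<^sub>h hnat n \<longleftrightarrow> m < n"
  by (auto simp: hmem_hnat hnat_inj)

lemma hmem_hupair: "u \<in>\<^sub>h hupair x y \<longleftrightarrow> u = x \<or> u = y"
  unfolding hmem_def hupair_def by simp

lemma hupair_eq_iff: "hupair x y = hupair x' y' \<longleftrightarrow> x = x' \<and> y = y' \<or> x = y' \<and> y = x'"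
  unfolding hc_eq_iff[of "hupair x y"] hmem_hupair by metis

lemma hpair_inj: "hpair x y = hpair x' y' \<longleftrightarrow> x = x' \<and> y = y'"
  unfolding hpair_def hupair_eq_iff by auto

lemma hmem_HC_acset: "countable A \<Longrightarrow> x \<in>\<^sub>h HC (acset A) \<longleftrightarrow> x \<in> A"
  unfolding hmem_def by (simp add: cin.rep_eq)

lemma hmem_hfun: "x \<in>\<^sub>h hfun f \<longleftrightarrow> (\<exists>n. x = hpair (hnat n) (hnat (f n)))"
  unfolding hfun_def by (subst hmem_HC_acset) auto

lemma hpair_mem_hfun: "hpair x y \<in>\<^sub>h hfun f \<longleftrightarrow> (\<exists>n. x = hnat n \<and> y = hnat (f n))"
  by (auto simp: hmem_hfun hpair_inj)

section \<open>Formulas for numerals, pairs and graphs of reals\<close>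

lemma definable_hnat_0: "definable (\<lambda>e. e i = hnat 0)"
proof -
  have "x = hnat 0 \<longleftrightarrow> (\<forall>u. \<not> u \<in>\<^sub>h x)" for x
    unfolding hc_eq_iff[of x] by (simp add: hmem_hnat_0)
  then show ?thesis by (simp only:) (intro definable_intros)
qed

text \<open>The natural numbers are the intersection of all inductive sets. The set of numerals is
  countable, so it is itself a possible value of \<open>I\<close>, which gives the converse.\<close>

lemma range_hnat_iff:
  "x \<in> range hnat \<longleftrightarrow> (\<forall>I. (\<forall>z. z = hnat 0 \<longrightarrow> z \<in>\<^sub>h I) \<and>
    (\<forall>y w. y \<in>\<^sub>h I \<and> (\<forall>u. u \<in>\<^sub>h w \<longleftrightarrow> u \<in>\<^sub>h y \<or> u = y) \<longrightarrow> w \<in>\<^sub>h I) \<longrightarrow> x \<in>\<^sub>h I)"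
  (is "_ \<longleftrightarrow> (\<forall>I. ?ind I \<longrightarrow> x \<in>\<^sub>h I)")
proof
  have "hnat n \<in>\<^sub>h I" if "?ind I" for n I
    using that by (induction n) (auto simp: hmem_hnat_Suc, metis hmem_hnat_Suc)
  then show "x \<in> range hnat \<Longrightarrow> \<forall>I. ?ind I \<longrightarrow> x \<in>\<^sub>h I" by blast
next
  have mem: "y \<in>\<^sub>h HC (acset (range hnat)) \<longleftrightarrow> y \<in> range hnat" for y
    by (simp add: hmem_HC_acset)
  have "?ind (HC (acset (range hnat)))"
    unfolding mem by (auto simp: hmem_hnat_Suc[symmetric] hc_eq_iff[symmetric])
  then show "\<forall>I. ?ind I \<longrightarrow> x \<in>\<^sub>h I \<Longrightarrow> x \<in> range hnat"
    using mem by blast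
qed

lemma definable_range_hnat: "definable (\<lambda>e. e i \<in> range hnat)"
  unfolding range_hnat_iff by (intro definable_intros definable_hnat_0)

lemma definable_hupair: "definable (\<lambda>e. e i = hupair (e j) (e k))"
  unfolding hc_eq_iff[of _ "hupair _ _"] hmem_hupair by (intro definable_intros)

text \<open>The language has no terms, so the inner pairs are named by quantified variables.\<close>

lemma definable_hpair: "definable (\<lambda>e. e i = hpair (e j) (e k))"
proof -
  have "p = hpair x y \<longleftrightarrow> (\<exists>a b. a = hupair x x \<and> b = hupair x y \<and> p = hupair a b)" for p x y
    unfolding hpair_def by simp
  then show ?thesis by (simp only:) (intro definable_intros definable_hupair)
qed

lemma definable_hpair_mem: "definable (\<lambda>e. hpair (e i) (e j) \<in>\<^sub>h e k)"
proof -
  have "hpair x y \<in>\<^sub>h z \<longleftrightarrow> (\<exists>p. p = hpair x y \<and> p \<in>\<^sub>h z)" for x y z by simp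
  then show ?thesis by (simp only:) (intro definable_intros definable_hpair)
qed

text \<open>Totality and uniqueness let a function \<open>f\<close> be read off \<open>z\<close>;
  the condition on pairs excludes further elements, and extensionality yields
  \<open>z = hfun f\<close>.\<close>

lemma range_hfun_iff:
  "z \<in> range hfun \<longleftrightarrow>
    (\<forall>p. p \<in>\<^sub>h z \<longrightarrow> (\<exists>x y. x \<in> range hnat \<and> y \<in> range hnat \<and> p = hpair x y)) \<and>
    (\<forall>x. x \<in> range hnat \<longrightarrow> (\<exists>y. \<forall>y'. hpair x y' \<in>\<^sub>h z \<longleftrightarrow> y' = y))"
  (is "_ \<longleftrightarrow> ?pairs \<and> ?total")
proof
  assume "z \<in> range hfun"
  then show "?pairs \<and> ?total"
    by (auto simp: hmem_hfun hpair_inj hnat_inj)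
next
  assume *: "?pairs \<and> ?total"
  then have "\<exists>m. \<forall>y. hpair (hnat n) y \<in>\<^sub>h z \<longleftrightarrow> y = hnat m" for n
    by (metis hpair_inj rangeE rangeI)
  then obtain f where f: "\<And>n y. hpair (hnat n) y \<in>\<^sub>h z \<longleftrightarrow> y = hnat (f n)" by metis
  have "p \<in>\<^sub>h z \<longleftrightarrow> p \<in>\<^sub>h hfun f" for p
    using * f unfolding hmem_hfun by (metis rangeE)
  then show "z \<in> range hfun" unfolding hc_eq_iff[symmetric]
    using hc_eq_iff by blast
qed

lemma definable_range_hfun: "definable (\<lambda>e. e i \<in> range hfun)"
  unfolding range_hfun_iff
  by (intro definable_intros definable_range_hnat definable_hpair definable_hpair_mem)


section \<open>Second-order arithmetic\<close>

text \<open>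
  Variables range over \<open>\<omega>\<^sup>\<omega>\<close>; a number variable is a function variable of which only the value at 0
  is used.
\<close>

definition so_definable :: "((nat \<Rightarrow> nat \<Rightarrow> nat) \<Rightarrow> bool) \<Rightarrow> bool"
  where "so_definable P \<longleftrightarrow> (\<exists>Q. definable Q \<and> (\<forall>s. Q (\<lambda>i. hfun (s i)) \<longleftrightarrow> P s))"

lemma so_definableI: "definable Q \<Longrightarrow> (\<And>s. Q (\<lambda>i. hfun (s i)) \<longleftrightarrow> P s) \<Longrightarrow> so_definable P"
  unfolding so_definable_def by blast

lemma so_definable_rename:
  assumes "so_definable P"
  shows "so_definable (\<lambda>s. P (\<lambda>i. s (\<sigma> i)))"
proof -
  obtain Q where Q: "definable Q" "\<And>s. Q (\<lambda>i. hfun (s i)) \<longleftrightarrow> P s"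
    using assms unfolding so_definable_def by blast
  show ?thesis by (rule so_definableI[OF definable_rename[OF Q(1)]]) (rule Q(2))
qed

lemma so_definable_not:
  assumes "so_definable P"
  shows "so_definable (\<lambda>s. \<not> P s)"
proof -
  obtain Q where Q: "definable Q" "\<And>s. Q (\<lambda>i. hfun (s i)) \<longleftrightarrow> P s"
    using assms unfolding so_definable_def by blast
  show ?thesis by (rule so_definableI[OF definable_not[OF Q(1)]]) (simp add: Q(2))
qed

lemma so_definable_conj:
  assumes "so_definable P" "so_definable P'"
  shows "so_definable (\<lambda>s. P s \<and> P' s)"
proof -
  obtain Q Q' where Q: "definable Q" "\<And>s. Q (\<lambda>i. hfun (s i)) \<longleftrightarrow> P s"
      "definable Q'" "\<And>s. Q' (\<lambda>i. hfun (s i)) \<longleftrightarrow> P' s"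
    using assms unfolding so_definable_def by blast
  show ?thesis by (rule so_definableI[OF definable_conj[OF Q(1,3)]]) (simp add: Q(2,4))
qed

lemma so_definable_disj:
  assumes "so_definable P" "so_definable Q"
  shows "so_definable (\<lambda>s. P s \<or> Q s)"
  using so_definable_not[OF so_definable_conj[OF assms[THEN so_definable_not]]] by simp

lemma so_definable_imp:
  assumes "so_definable P" "so_definable Q"
  shows "so_definable (\<lambda>s. P s \<longrightarrow> Q s)"
  using so_definable_disj[OF so_definable_not[OF assms(1)] assms(2)] unfolding imp_conv_disj .

lemma so_definable_iff:
  assumes "so_definable P" "so_definable Q"
  shows "so_definable (\<lambda>s. P s \<longleftrightarrow> Q s)"
  using so_definable_conj[OF so_definable_imp[OF assms] so_definable_imp[OF assms(2,1)]]
  unfolding iff_conv_conj_imp .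

text \<open>A quantifier over reals is a quantifier over \<open>hc\<close> relativised to the
  definable class \<open>range hfun\<close>.\<close>

lemma so_definable_ex_fun:
  assumes "so_definable (\<lambda>s. P (\<lambda>i. s (Suc i)) (s 0))"
  shows "so_definable (\<lambda>s. \<exists>t::nat \<Rightarrow> nat. P s t)"
proof -
  obtain Q where Q: "definable Q" "\<And>s. Q (\<lambda>i. hfun (s i)) \<longleftrightarrow> P (\<lambda>i. s (Suc i)) (s 0)"
    using assms unfolding so_definable_def by blast
  \<comment> \<open>The shift in \<open>definable_ex\<close> undoes the insertion by
    \<open>case_nat\<close>, so its premise reduces to definability of \<open>Q\<close>.\<close>
  have "case_nat (e 0) (\<lambda>i. e (Suc i)) = e" for e :: "nat \<Rightarrow> hc"
    by (auto simp: fun_eq_iff split: nat.split)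
  with Q(1) have "definable (\<lambda>e. \<exists>x. x \<in> range hfun \<and> Q (case_nat x e))"
    by (intro definable_intros definable_range_hfun) simp
  moreover have "(\<exists>x. x \<in> range hfun \<and> Q (case_nat x (\<lambda>i. hfun (s i)))) \<longleftrightarrow> (\<exists>t. P s t)" for s
  proof -
    have "case_nat (hfun t) (\<lambda>i. hfun (s i)) = (\<lambda>i. hfun (case_nat t s i))" for t
      by (auto simp: fun_eq_iff split: nat.split)
    then show ?thesis using Q(2)[of "case_nat _ s"] by auto
  qed
  ultimately show ?thesis by (rule so_definableI)
qed

lemma so_definable_all_fun:
  assumes "so_definable (\<lambda>s. P (\<lambda>i. s (Suc i)) (s 0))"
  shows "so_definable (\<lambda>s. \<forall>t::nat \<Rightarrow> nat. P s t)"
  using so_definable_not[OF so_definable_ex_fun[where P = "\<lambda>s x. \<not> P s x", OF so_definable_not[OF assms]]] by simp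

lemma so_definable_ex_nat:
  assumes "so_definable (\<lambda>s. P (\<lambda>i. s (Suc i)) (s 0 0))"
  shows "so_definable (\<lambda>s. \<exists>n::nat. P s n)"
proof -
  have "(\<exists>n. P s n) \<longleftrightarrow> (\<exists>t::nat \<Rightarrow> nat. P s (t 0))" for s
  proof
    assume "\<exists>n. P s n"
    then obtain n where "P s n" by blast
    then show "\<exists>t::nat \<Rightarrow> nat. P s (t 0)" by (intro exI[of _ "\<lambda>_. n"])
  qed blast
  then show ?thesis by (simp only:) (rule so_definable_ex_fun, rule assms)
qed

lemma so_definable_all_nat:
  assumes "so_definable (\<lambda>s. P (\<lambda>i. s (Suc i)) (s 0 0))"
  shows "so_definable (\<lambda>s. \<forall>n::nat. P s n)"
  using so_definable_not[OF so_definable_ex_nat[where P = "\<lambda>s x. \<not> P s x", OF so_definable_not[OF assms]]] by simp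

lemmas so_definable_logic =
  so_definable_not so_definable_conj so_definable_disj so_definable_imp so_definable_iff
  so_definable_ex_fun so_definable_all_fun so_definable_ex_nat so_definable_all_nat

text \<open>Each number is fetched from the graph of its variable as the partner of
  \<open>hnat 0\<close>; the last membership is the application itself.\<close>

lemma so_definable_app: "so_definable (\<lambda>s. s i (s j 0) = s k 0)"
proof (rule so_definableI)
  show "definable (\<lambda>e. \<exists>z m n. z = hnat 0 \<and>
      hpair z m \<in>\<^sub>h e j \<and> hpair z n \<in>\<^sub>h e k \<and> hpair m n \<in>\<^sub>h e i)"
    by (intro definable_intros definable_hnat_0 definable_hpair_mem)
qed (auto simp: hpair_mem_hfun hnat_inj)

lemma so_definable_less_var: "so_definable (\<lambda>s. s i 0 < s j 0)"
proof (rule so_definableI)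
  show "definable (\<lambda>e. \<exists>z m n. z = hnat 0 \<and>
      hpair z m \<in>\<^sub>h e i \<and> hpair z n \<in>\<^sub>h e j \<and> m \<in>\<^sub>h n)"
    by (intro definable_intros definable_hnat_0 definable_hpair_mem)
qed (auto simp: hpair_mem_hfun hnat_inj hmem_hnat_iff)

section \<open>Numerical terms and substitution\<close>

text \<open>A term is represented by its graph, with the value in variable 0 and the arguments
  shifted by one.\<close>

definition so_term :: "((nat \<Rightarrow> nat \<Rightarrow> nat) \<Rightarrow> nat) \<Rightarrow> bool"
  where "so_term T \<longleftrightarrow> so_definable (\<lambda>s. s 0 0 = T (\<lambda>i. s (Suc i)))"

text \<open>Weakening under a binder: the value stays in variable 0, and variable 1, the newly bound
  one, is skipped.\<close>

lemma so_term_shift: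
  assumes "so_term T"
  shows "so_term (\<lambda>s. T (\<lambda>i. s (Suc i)))"
  using so_definable_rename[of _ "case_nat 0 (\<lambda>i. Suc (Suc i))", OF assms[unfolded so_term_def]]
  unfolding so_term_def by simp

lemma so_definable_subst:
  assumes P: "so_definable (\<lambda>s. P (\<lambda>i. s (Suc i)) (s 0 0))" and T: "so_term T"
  shows "so_definable (\<lambda>s. P s (T s))"
proof -
  have "so_definable (\<lambda>s. \<exists>n. n = T s \<and> P s n)"
    using T unfolding so_term_def by (intro so_definable_logic P)
  then show ?thesis by simp
qed

text \<open>Equality of function variables would compare more than the values at 0, so numbers are
  compared through their predecessors.\<close>

lemma so_term_var: "so_term (\<lambda>s. s i 0)"
proof -
  have "so_definable (\<lambda>s. \<forall>n. n < s 0 0 \<longleftrightarrow> n < s (Suc i) 0)"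
    by (intro so_definable_logic so_definable_less_var)
  moreover have "(\<forall>n. n < a \<longleftrightarrow> n < b) \<longleftrightarrow> a = b" for a b :: nat
    using nat_neq_iff by blast
  ultimately show ?thesis unfolding so_term_def by simp
qed

lemma so_term_0: "so_term (\<lambda>s. 0)"
proof -
  have "so_definable (\<lambda>s. \<forall>n. \<not> n < s 0 0)"
    by (intro so_definable_logic so_definable_less_var)
  moreover have "(\<forall>n. \<not> n < a) \<longleftrightarrow> a = 0" for a :: nat
    by auto
  ultimately show ?thesis unfolding so_term_def by simp
qed

lemma so_term_Suc:
  assumes "so_term T"
  shows "so_term (\<lambda>s. Suc (T s))"
proof -
  have "so_definable (\<lambda>s. \<forall>n. n < s (Suc 0) 0 \<longleftrightarrow> \<not> s 0 0 < n)"
    by (intro so_definable_logic so_definable_less_var)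
  \<comment> \<open>The order alone captures the successor: \<open>\<not> b < n\<close> says that
    \<open>n\<close> is at most \<open>b\<close>.\<close>
  moreover have "(\<forall>n. n < a \<longleftrightarrow> \<not> b < n) \<longleftrightarrow> a = Suc b" for a b :: nat
    by (metis less_Suc_eq_le not_less nat_neq_iff)
  ultimately have S: "so_definable (\<lambda>s. s (Suc 0) 0 = Suc (s 0 0))"
    by simp
  from so_definable_subst[where P = "\<lambda>s n. s 0 0 = Suc n", OF S so_term_shift[OF assms]] show ?thesis
    unfolding so_term_def .
qed

lemma so_term_app:
  assumes "so_term T"
  shows "so_term (\<lambda>s. s i (T s))"
proof -
  have S: "so_definable (\<lambda>s. s (Suc 0) 0 = s (Suc (Suc i)) (s 0 0))"
    using so_definable_app by (subst eq_commute)
  from so_definable_subst[where P = "\<lambda>s n. s 0 0 = s (Suc i) n", OF S so_term_shift[OF assms]] show ?thesis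
    unfolding so_term_def .
qed

text \<open>\<open>U\<close> is substituted first, while the value of \<open>T\<close> still
  occupies variable 0; hence the shift of \<open>U\<close>.\<close>

lemma so_definable_subst2:
  assumes P: "so_definable (\<lambda>s. P (\<lambda>i. s (Suc (Suc i))) (s (Suc 0) 0) (s 0 0))"
    and T: "so_term T" and U: "so_term U"
  shows "so_definable (\<lambda>s. P s (T s) (U s))"
proof -
  from so_definable_subst[where P = "\<lambda>s n. P (\<lambda>i. s (Suc i)) (s 0 0) n", OF P so_term_shift[OF U]]
  show ?thesis by (rule so_definable_subst[OF _ T])
qed

lemma so_definable_eq: "so_term T \<Longrightarrow> so_term U \<Longrightarrow> so_definable (\<lambda>s. T s = U s)"
  by (rule so_definable_subst2[where P = "\<lambda>s a b. a = b"])
    (rule so_term_var[unfolded so_term_def,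
      THEN so_definable_rename[of _ "case_nat (Suc 0) (\<lambda>_. 0)"], simplified])

lemma so_definable_less: "so_term T \<Longrightarrow> so_term U \<Longrightarrow> so_definable (\<lambda>s. T s < U s)"
  by (rule so_definable_subst2[where P = "\<lambda>s a b. a < b"]) (rule so_definable_less_var)

lemmas so_definable_intros =
  so_definable_logic so_definable_eq so_definable_less so_term_0 so_term_Suc so_term_app

section \<open>From definability to membership in elementary submodels\<close>

text \<open>Elementarity is used twice: the existential statement passes down to \<open>M\<close>
  and gives a witness there, and the formula passes back up for that witness, where uniqueness
  identifies it with \<open>g\<close>.\<close>

lemma reals_closed_under_so_definable:
  assumes M: "elementary_submodel M" and P: "so_definable P"
    and ps: "\<And>i. ps i \<in> reals M"
    and uniq: "\<And>t. P (case_nat t ps) \<longleftrightarrow> t = g"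
  shows "g \<in> reals M"
proof -
  obtain Q where Q: "definable Q" "\<And>s. Q (\<lambda>i. hfun (s i)) \<longleftrightarrow> P s"
    using P unfolding so_definable_def by blast
  have "definable (\<lambda>e. e 0 \<in> range hfun \<and> Q e)"
    by (intro definable_intros definable_range_hfun Q)
  then obtain \<phi> where \<phi>: "\<And>e. sat UNIV \<phi> e \<longleftrightarrow> e 0 \<in> range hfun \<and> Q e"
    unfolding definable_def by blast
  \<comment> \<open>The entry \<open>ps 0\<close> at variable 0 is a filler that keeps the
    environment inside \<open>M\<close>; the quantifier overwrites it.\<close>
  define e where "e = (\<lambda>i. hfun (case_nat (ps 0) ps i))"
  have upd: "e(0 := hfun t) = (\<lambda>i. hfun (case_nat t ps i))" for t
    unfolding e_def by (auto simp: fun_eq_iff split: nat.split)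
  have e: "range e \<subseteq> M"
    using ps unfolding e_def reals_def by (auto split: nat.split)
  have "sat UNIV \<phi> (e(0 := hfun g))"
    by (simp add: \<phi> upd Q uniq)
  then have "sat UNIV (Ex 0 \<phi>) e" by auto
  then have "sat M (Ex 0 \<phi>) e"
    using M e unfolding elementary_submodel_def by blast
  then obtain x where x: "x \<in> M" "sat M \<phi> (e(0 := x))" by auto
  moreover have "range (e(0 := x)) \<subseteq> M" using e x(1) by auto
  ultimately have "sat UNIV \<phi> (e(0 := x))"
    using M unfolding elementary_submodel_def by blast
  then obtain t where "x = hfun t" "Q (e(0 := x))" by (auto simp: \<phi>)
  then have "x = hfun g" using upd Q uniq by metis
  with x(1) show ?thesis unfolding reals_def by simp
qed


section \<open>Definability of oracle computations\<close>

inductive_cases computes_ZeroE: "computes h Zero xs y"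
inductive_cases computes_SuccE: "computes h Succ xs y"
inductive_cases computes_ProjE: "computes h (Proj i) xs y"
inductive_cases computes_OracleE: "computes h Oracle xs y"
inductive_cases computes_CompE: "computes h (Comp c ds) xs y"
inductive_cases computes_PrimRecE: "computes h (PrimRec c d) xs y"
inductive_cases computes_MuE: "computes h (Mu c) xs y"

text \<open>Second-order variables cannot hold lists, so argument lists are coded as
  \<open>map s [0..<n]\<close> by a function and a length.\<close>

lemma map_upt_eq_singleton: "map s [0..<n] = [x] \<longleftrightarrow> n = Suc 0 \<and> x = s 0"
  by (cases n; cases "n - 1") (auto simp: map_upt_Suc simp del: upt_Suc)

lemma computes_Zero_iff: "computes h Zero (map s [0..<n]) y \<longleftrightarrow> y = 0"
  by (auto elim: computes_ZeroE intro: computes.intros)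

lemma computes_Succ_iff: "computes h Succ (map s [0..<n]) y \<longleftrightarrow> n = Suc 0 \<and> y = Suc (s 0)"
proof -
  have "computes h Succ xs y \<longleftrightarrow> (\<exists>x. xs = [x] \<and> y = Suc x)" for xs
    by (auto elim: computes_SuccE intro: computes.intros)
  then show ?thesis by (auto simp: map_upt_eq_singleton simp del: upt_Suc)
qed

lemma computes_Oracle_iff: "computes h Oracle (map s [0..<n]) y \<longleftrightarrow> n = Suc 0 \<and> y = h (s 0)"
proof -
  have "computes h Oracle xs y \<longleftrightarrow> (\<exists>x. xs = [x] \<and> y = h x)" for xs
    by (auto elim: computes_OracleE intro: computes.intros)
  then show ?thesis by (auto simp: map_upt_eq_singleton simp del: upt_Suc)
qed

lemma computes_Proj_iff: "computes h (Proj i) (map s [0..<n]) y \<longleftrightarrow> i < n \<and> y = s i"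
proof -
  have "computes h (Proj i) xs y \<longleftrightarrow> i < length xs \<and> y = xs ! i" for xs
    by (auto elim: computes_ProjE intro: computes.intros(3))
  then show ?thesis by (simp cong: conj_cong)
qed

text \<open>The intermediate results are collected in one function \<open>t\<close>, of which the
  first \<open>length ds\<close> values matter.\<close>

lemma computes_Comp_iff:
  "computes h (Comp c ds) xs y \<longleftrightarrow> (\<exists>t. (\<forall>i<length ds. computes h (ds ! i) xs (t i)) \<and>
    computes h c (map t [0..<length ds]) y)"
proof
  assume "computes h (Comp c ds) xs y"
  then obtain ys where ys: "list_all2 (\<lambda>d y. computes h d xs y) ds ys" "computes h c ys y"
    by (auto elim: computes_CompE)
  then have "map ((!) ys) [0..<length ds] = ys"
    by (metis list_all2_lengthD map_nth)
  with ys show "\<exists>t. (\<forall>i<length ds. computes h (ds ! i) xs (t i)) \<and> computes h c (map t [0..<length ds]) y"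
    by (intro exI[of _ "(!) ys"]) (auto simp: list_all2_conv_all_nth)
next
  assume "\<exists>t. (\<forall>i<length ds. computes h (ds ! i) xs (t i)) \<and> computes h c (map t [0..<length ds]) y"
  then show "computes h (Comp c ds) xs y"
    by (auto intro!: computes.intros(5) simp: list_all2_conv_all_nth)
qed

text \<open>The function \<open>r\<close> records the values of the recursion up to
  \<open>n\<close>; quantifying over it replaces any coding of finite sequences.\<close>

lemma computes_PrimRec_Cons_iff:
  "computes h (PrimRec c d) (n # xs) y \<longleftrightarrow>
    (\<exists>r. computes h c xs (r 0) \<and> (\<forall>j<n. computes h d (j # r j # xs) (r (Suc j))) \<and> r n = y)"
proof
  assume "computes h (PrimRec c d) (n # xs) y"
  then show "\<exists>r. computes h c xs (r 0) \<and> (\<forall>j<n. computes h d (j # r j # xs) (r (Suc j))) \<and> r n = y"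
  proof (induction n arbitrary: y)
    case 0
    then show ?case by (auto elim: computes_PrimRecE)
  next
    case (Suc n)
    then obtain z where z: "computes h (PrimRec c d) (n # xs) z" "computes h d (n # z # xs) y"
      by (auto elim: computes_PrimRecE)
    then obtain r where "computes h c xs (r 0)" "\<forall>j<n. computes h d (j # r j # xs) (r (Suc j))" "r n = z"
      using Suc.IH by blast
    with z(2) show ?case
      by (intro exI[of _ "r(Suc n := y)"]) (auto simp: less_Suc_eq)
  qed
next
  assume "\<exists>r. computes h c xs (r 0) \<and> (\<forall>j<n. computes h d (j # r j # xs) (r (Suc j))) \<and> r n = y"
  then obtain r where r: "computes h c xs (r 0)" "\<forall>j<n. computes h d (j # r j # xs) (r (Suc j))" "r n = y"
    by blast
  have "m \<le> n \<Longrightarrow> computes h (PrimRec c d) (m # xs) (r m)" for m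
    by (induction m) (use r in \<open>auto intro: computes.intros\<close>)
  with r(3) show "computes h (PrimRec c d) (n # xs) y" by blast
qed

lemma map_upt_Cons_iff: "map s [0..<n] = x # xs \<longleftrightarrow>
    (\<exists>k. n = Suc k \<and> x = s 0 \<and> xs = map (\<lambda>i. s (Suc i)) [0..<k])"
  by (cases n) (auto simp: map_upt_Suc simp del: upt_Suc)

text \<open>The shortened and extended argument lists are given by functions \<open>t\<close> and
  \<open>v\<close>, fixed by equations, so that each subcomputation again has the form to which an
  induction hypothesis applies.\<close>

lemma computes_PrimRec_iff:
  "computes h (PrimRec c d) (map s [0..<n]) y \<longleftrightarrow>
    (\<exists>k t r. n = Suc k \<and> (\<forall>i. t i = s (Suc i)) \<and> computes h c (map t [0..<k]) (r 0) \<and>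
      (\<forall>j. j < s 0 \<longrightarrow> (\<exists>v. v 0 = j \<and> v (Suc 0) = r j \<and> (\<forall>i. v (Suc (Suc i)) = t i) \<and>
        computes h d (map v [0..<Suc (Suc k)]) (r (Suc j)))) \<and> r (s 0) = y)"
proof -
  have v: "(\<exists>v. v 0 = a \<and> v (Suc 0) = b \<and> (\<forall>i. v (Suc (Suc i)) = t i) \<and>
        computes h d (map v [0..<Suc (Suc k)]) z) \<longleftrightarrow> computes h d (a # b # map t [0..<k]) z"
    for a b z k and t :: "nat \<Rightarrow> nat"
  proof -
    have "map v [0..<Suc (Suc k)] = v 0 # v (Suc 0) # map (\<lambda>i. v (Suc (Suc i))) [0..<k]" for v :: "nat \<Rightarrow> nat"
      by (simp add: map_upt_Suc del: upt_Suc)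
    then show ?thesis
      by (auto simp del: upt_Suc intro!: exI[of _ "case_nat a (case_nat b t)"])
  qed
  have t: "(\<forall>i. t i = s (Suc i)) \<longleftrightarrow> t = (\<lambda>i. s (Suc i))" for t by auto
  \<comment> \<open>Primitive recursion diverges on the empty list, so the length is a
    successor.\<close>
  have "computes h (PrimRec c d) xs y \<Longrightarrow> \<exists>n xs'. xs = n # xs'" for xs
    by (auto elim: computes_PrimRecE)
  then have "computes h (PrimRec c d) (map s [0..<n]) y \<longleftrightarrow>
      (\<exists>k. n = Suc k \<and> computes h (PrimRec c d) (s 0 # map (\<lambda>i. s (Suc i)) [0..<k]) y)"
    using map_upt_Cons_iff by metis
  then show ?thesis
    unfolding v t computes_PrimRec_Cons_iff by auto
qed

text \<open>Here \<open>v\<close> is \<open>s\<close> with the candidate for the minimum put in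
  front.\<close>

lemma computes_Mu_iff:
  "computes h (Mu c) (map s [0..<n]) y \<longleftrightarrow>
    (\<exists>v. v 0 = y \<and> (\<forall>i. v (Suc i) = s i) \<and> computes h c (map v [0..<Suc n]) 0) \<and>
    (\<forall>m. m < y \<longrightarrow> (\<exists>r. r \<noteq> 0 \<and>
      (\<exists>v. v 0 = m \<and> (\<forall>i. v (Suc i) = s i) \<and> computes h c (map v [0..<Suc n]) r)))"
proof -
  have v: "(\<exists>v. v 0 = a \<and> (\<forall>i. v (Suc i) = s i) \<and> computes h c (map v [0..<Suc n]) z)
      \<longleftrightarrow> computes h c (a # map s [0..<n]) z" for a z
  proof -
    have "map v [0..<Suc n] = v 0 # map (\<lambda>i. v (Suc i)) [0..<n]" for v :: "nat \<Rightarrow> nat"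
      by (simp add: map_upt_Suc del: upt_Suc)
    then show ?thesis
      by (auto simp del: upt_Suc intro!: exI[of _ "case_nat a s"])
  qed
  have "computes h (Mu c) xs y \<longleftrightarrow> computes h c (y # xs) 0 \<and> (\<forall>m<y. \<exists>r. r \<noteq> 0 \<and> computes h c (m # xs) r)" for xs
    by (blast elim: computes_MuE intro: computes.intros(8))
  then show ?thesis unfolding v .
qed

lemma so_term_const: "so_term (\<lambda>s. n)"
  by (induction n) (auto intro: so_term_0 so_term_Suc)

text \<open>The bound is fixed outside the formula, which becomes a finite conjunction; the
  conjuncts may be unrelated, as with the different programs in a composition.\<close>

lemma so_definable_ball_lessThan:
  assumes "\<And>i::nat. i < n \<Longrightarrow> so_definable (\<lambda>s. P s i)"
  shows "so_definable (\<lambda>s. \<forall>i<n. P s i)"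
  using assms
proof (induction n)
  case 0
  have "so_definable (\<lambda>s. 0 = (0::nat))" by (intro so_definable_intros)
  then show ?case by simp
next
  case (Suc n)
  then have "so_definable (\<lambda>s. P s n \<and> (\<forall>i<n. P s i))" by (intro so_definable_conj) auto
  then show ?case by (simp add: All_less_Suc)
qed

lemma so_definable_computes_subst:
  assumes "\<And>i j k l. so_definable (\<lambda>s. computes (s i) c (map (s j) [0..<s k 0]) (s l 0))"
    and "so_term T" "so_term U"
  shows "so_definable (\<lambda>s. computes (s i) c (map (s j) [0..<T s]) (U s))"
  by (rule so_definable_subst2[where P = "\<lambda>s a b. computes (s i) c (map (s j) [0..<a]) b"])
    (use assms in auto)

text \<open>Induction on the program, which stays outside the formula: each program gets its own.
  The indices are arbitrary because quantifiers shift the variables.\<close>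

lemma so_definable_computes:
  "so_definable (\<lambda>s. computes (s i) c (map (s j) [0..<s k 0]) (s l 0))"
proof (induction c arbitrary: i j k l)
  case Zero
  then show ?case unfolding computes_Zero_iff by (intro so_definable_intros)
next
  case Succ
  then show ?case unfolding computes_Succ_iff by (intro so_definable_intros)
next
  case (Proj m)
  then show ?case unfolding computes_Proj_iff by (intro so_definable_intros so_term_const)
next
  case Oracle
  then show ?case unfolding computes_Oracle_iff by (intro so_definable_intros)
next
  case (Comp c ds)
  have nth: "so_definable (\<lambda>s. computes (s i) (ds ! m) (map (s j) [0..<T s]) (U s))"
    if "m < length ds" "so_term T" "so_term U" for m T U i j
    by (rule so_definable_computes_subst[OF Comp(2) that(2,3)]) (simp add: that(1))
  show ?case unfolding computes_Comp_iff
    by (intro so_definable_ex_fun so_definable_conj so_definable_ball_lessThan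
      so_definable_computes_subst[OF Comp(1)] nth so_term_app so_term_const)
next
  case (PrimRec c d)
  show ?case unfolding computes_PrimRec_iff
    by (intro so_definable_intros so_definable_computes_subst[OF PrimRec(1)]
      so_definable_computes_subst[OF PrimRec(2)])
next
  case (Mu c)
  show ?case unfolding computes_Mu_iff
    by (intro so_definable_intros so_definable_computes_subst[OF Mu])
qed

section \<open>Closure properties of the reals of an elementary submodel\<close>

lemma reals_closed_under_turing_reducible:
  assumes M: "elementary_submodel M" and f: "f \<in> reals M" and g: "g \<le>\<^sub>T f"
  shows "g \<in> reals M"
proof -
  obtain c where c: "\<And>n y. computes f c [n] y \<longleftrightarrow> y = g n"
    using g unfolding turing_reducible_def by blast
  \<comment> \<open>Variable 1 is the oracle and variable 0 the result. The input is
    \<open>t 0\<close>, with a function \<open>t\<close> in place of a number to match the coding of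
    lists.\<close>
  let ?P = "\<lambda>s. \<forall>t y. computes (s (Suc 0)) c (map t [0..<Suc 0]) y \<longleftrightarrow> y = s 0 (t 0)"
  have "so_definable ?P"
    by (intro so_definable_intros so_definable_computes_subst[OF so_definable_computes])
  then show ?thesis
  proof (rule reals_closed_under_so_definable[OF M, where ps = "\<lambda>_. f"])
    show "?P (case_nat u (\<lambda>_. f)) \<longleftrightarrow> u = g" for u
      using c by (auto simp: fun_eq_iff)
  qed (rule f)
qed

lemma reals_closed_under_join:
  assumes M: "elementary_submodel M" and f: "f \<in> reals M" and g: "g \<in> reals M"
  shows "join f g \<in> reals M"
proof -
  \<comment> \<open>The doubling function \<open>d\<close> is introduced by its recursion, since
    terms offer only zero, successor and application. \<open>Suc i\<close> is the value of
    \<open>(n + 1) div 2\<close> at \<open>n = 2 * i + 1\<close>.\<close>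
  let ?P = "\<lambda>s. \<exists>d. d 0 = 0 \<and> (\<forall>i. d (Suc i) = Suc (Suc (d i))) \<and>
    (\<forall>i. s 0 (d i) = s (Suc 0) i \<and> s 0 (Suc (d i)) = s (Suc (Suc 0)) (Suc i))"
  have "so_definable ?P" by (intro so_definable_intros)
  then show ?thesis
  proof (rule reals_closed_under_so_definable[OF M, where ps = "case_nat f (\<lambda>_. g)"])
    fix u
    have d: "d 0 = 0 \<and> (\<forall>i. d (Suc i) = Suc (Suc (d i))) \<longleftrightarrow> d = (\<lambda>i. 2 * i)" for d
    proof
      assume "d 0 = 0 \<and> (\<forall>i. d (Suc i) = Suc (Suc (d i)))"
      then have "d i = 2 * i" for i by (induction i) auto
      then show "d = (\<lambda>i. 2 * i)" by auto
    qed auto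
    have "?P (case_nat u (case_nat f (\<lambda>_. g))) \<longleftrightarrow> (\<forall>i. u (2 * i) = f i \<and> u (Suc (2 * i)) = g (Suc i))"
      unfolding conj_assoc[symmetric] d by simp
    also have "\<dots> \<longleftrightarrow> u = join f g"
    proof
      assume *: "\<forall>i. u (2 * i) = f i \<and> u (Suc (2 * i)) = g (Suc i)"
      have "u n = join f g n" for n
        by (cases "even n") (auto simp: join_def * elim!: evenE oddE)
      then show "u = join f g" by auto
    qed (simp add: join_def)
    finally show "?P (case_nat u (case_nat f (\<lambda>_. g))) \<longleftrightarrow> u = join f g" .
  qed (use f g in \<open>auto split: nat.split\<close>)
qed


section \<open>Pathways\<close>

lemma le_star_refl: "f \<le>\<^sup>* f"
  unfolding le_star_def by simp

text \<open>An infinite cardinal is a limit order, so strict upper bounds exist and a least one can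
  be taken.\<close>

lemma ord_suc_greater:
  assumes "Cinfinite r" "a \<in> Field r"
  shows "(a, ord_suc r a) \<in> r" "ord_suc r a \<noteq> a" "ord_suc r a \<in> Field r"
proof -
  have wo: "wo_rel r"
    using assms(1) unfolding wo_rel_def card_order_on_def by simp
  obtain b where "b \<in> Field r" "a \<noteq> b" "(a, b) \<in> r"
    using infinite_Card_order_limit assms unfolding cinfinite_def by metis
  then have "AboveS r {a} \<noteq> {}" unfolding AboveS_def by auto
  with wo assms(2) have "ord_suc r a \<in> AboveS r {a}"
    unfolding ord_suc_def by (intro wo_rel.suc_AboveS) auto
  then show "(a, ord_suc r a) \<in> r" "ord_suc r a \<noteq> a" "ord_suc r a \<in> Field r"
    unfolding AboveS_def by auto
qed

lemma ord_suc_least: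
  assumes "Cinfinite r" "(a, b) \<in> r" "a \<noteq> b"
  shows "(ord_suc r a, b) \<in> r"
proof -
  have wo: "wo_rel r"
    using assms(1) unfolding wo_rel_def card_order_on_def by simp
  have "b \<in> AboveS r {a}" using assms unfolding AboveS_def Field_def by auto
  then show ?thesis unfolding ord_suc_def by (rule wo_rel.suc_least_AboveS[OF wo])
qed

lemma MH_sequence_imp_pathway:
  assumes "MH_sequence \<kappa> M"
  shows "pathway \<kappa> (\<lambda>\<alpha>. reals (M \<alpha>))"
  using assms reals_closed_under_join reals_closed_under_turing_reducible
  unfolding MH_sequence_def pathway_def relChain_def reals_def by blast

section \<open>Re-indexing a pathway by a cardinal on the reals\<close>

text \<open>If \<open>\<alpha>\<close> precedes \<open>\<beta>\<close>, the real chosen for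
  \<open>\<alpha>\<close> already lies in \<open>A \<beta>\<close>, whereas the one chosen for
  \<open>\<beta>\<close> does not, being bounded by itself.\<close>

lemma pathway_inj:
  assumes "pathway \<kappa> A"
  shows "\<exists>F :: 'k \<Rightarrow> nat \<Rightarrow> nat. inj_on F (Field \<kappa>)"
proof -
  have \<kappa>: "Cinfinite \<kappa>" and chain: "\<And>\<alpha> \<beta>. (\<alpha>, \<beta>) \<in> \<kappa> \<Longrightarrow> A \<alpha> \<subseteq> A \<beta>"
    using assms unfolding pathway_def relChain_def by auto
  obtain F where F: "\<And>\<alpha>. \<alpha> \<in> Field \<kappa> \<Longrightarrow> F \<alpha> \<in> A (ord_suc \<kappa> \<alpha>)"
      "\<And>\<alpha> g. \<alpha> \<in> Field \<kappa> \<Longrightarrow> g \<in> A \<alpha> \<Longrightarrow> \<not> F \<alpha> \<le>\<^sup>* g"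
    using assms unfolding pathway_def by metis
  have neq: "F \<alpha> \<noteq> F \<beta>" if "(\<alpha>, \<beta>) \<in> \<kappa>" "\<alpha> \<noteq> \<beta>" for \<alpha> \<beta>
  proof -
    have "\<alpha> \<in> Field \<kappa>" "\<beta> \<in> Field \<kappa>" using that by (auto simp: Field_def)
    then have "F \<alpha> \<in> A \<beta>" "F \<beta> \<notin> A \<beta>"
      using F le_star_refl chain ord_suc_least[OF \<kappa> that] by blast+
    then show ?thesis by metis
  qed
  have "total_on (Field \<kappa>) \<kappa>"
    using \<kappa> unfolding card_order_on_def well_order_on_def linear_order_on_def by blast
  then have "inj_on F (Field \<kappa>)"
    using neq unfolding inj_on_def total_on_def by metis
  then show ?thesis by blast
qed

text \<open>Unboundedness carries over by monotonicity: the inverse image of a successor lies at or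
  above the successor of the inverse image.\<close>

lemma pathway_dir_image:
  assumes path: "pathway \<kappa> A" and inj: "inj_on F (Field \<kappa>)"
  shows "pathway (dir_image \<kappa> F) (\<lambda>\<beta>. A (inv_into (Field \<kappa>) F \<beta>))"
proof -
  let ?\<kappa> = "dir_image \<kappa> F" and ?G = "inv_into (Field \<kappa>) F"
  have \<kappa>: "Cinfinite \<kappa>" and chain: "\<And>\<alpha> \<beta>. (\<alpha>, \<beta>) \<in> \<kappa> \<Longrightarrow> A \<alpha> \<subseteq> A \<beta>"
    using path unfolding pathway_def relChain_def by auto
  have iso: "(\<kappa>, ?\<kappa>) \<in> ordIso"
    using dir_image_ordIso[OF _ inj] \<kappa> unfolding card_order_on_def by blast
  have \<kappa>': "Cinfinite ?\<kappa>"
    using Cinfinite_cong[OF iso \<kappa>] .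
  have field: "Field ?\<kappa> = F ` Field \<kappa>" by (rule dir_image_Field)
  have G: "(?G \<beta>, ?G \<gamma>) \<in> \<kappa>" if "(\<beta>, \<gamma>) \<in> ?\<kappa>" for \<beta> \<gamma>
    using that inj unfolding dir_image_def by (auto simp: FieldI1 FieldI2)
  have field_G: "?G ` Field ?\<kappa> = Field \<kappa>"
    unfolding field using inj by simp
  have "\<exists>f\<in>A (?G (ord_suc ?\<kappa> \<beta>)). \<forall>g\<in>A (?G \<beta>). \<not> f \<le>\<^sup>* g" if \<beta>: "\<beta> \<in> Field ?\<kappa>" for \<beta>
  proof -
    have "?G \<beta> \<noteq> ?G (ord_suc ?\<kappa> \<beta>)"
      using ord_suc_greater[OF \<kappa>' \<beta>] \<beta> unfolding field by (metis f_inv_into_f)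
    then have "(ord_suc \<kappa> (?G \<beta>), ?G (ord_suc ?\<kappa> \<beta>)) \<in> \<kappa>"
      using ord_suc_least[OF \<kappa>] G ord_suc_greater(1)[OF \<kappa>' \<beta>] by blast
    moreover have "?G \<beta> \<in> Field \<kappa>" using \<beta> field_G by blast
    ultimately show ?thesis
      using path chain unfolding pathway_def by blast
  qed
  moreover have "(\<Union>\<beta>\<in>Field ?\<kappa>. A (?G \<beta>)) = UNIV"
  proof -
    have "(\<Union>\<beta>\<in>Field ?\<kappa>. A (?G \<beta>)) = (\<Union>\<alpha>\<in>?G ` Field ?\<kappa>. A \<alpha>)" by simp
    also have "\<dots> = UNIV" unfolding field_G using path unfolding pathway_def by blast
    finally show ?thesis .
  qed
  moreover have "relChain ?\<kappa> (\<lambda>\<beta>. A (?G \<beta>))"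
    unfolding relChain_def using G chain by blast
  moreover have "?G \<beta> \<in> Field \<kappa>" if "\<beta> \<in> Field ?\<kappa>" for \<beta>
    using that field_G by blast
  ultimately show ?thesis
    using path \<kappa>' unfolding pathway_def by blast
qed

theorem theorem3p1:
  assumes "MH TYPE('k)"
  shows "\<exists>(\<kappa> :: (nat \<Rightarrow> nat) rel) A. pathway \<kappa> A"
  using assms MH_sequence_imp_pathway pathway_inj pathway_dir_image
  unfolding MH_def by metis

end
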